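(* Let $(H,\langle\cdot,\cdot\rangle)$ be an inner product space over $\mathbb{K}$ ($\mathbb{K}=\mathbb{R}$ or $\mathbb{C}$), let $\{e_i\}_{i\in I}$ be a family of orthonormal vectors in $H$, let $F$ be a finite subset of $I$, let $\phi_i,\Phi_i,\gamma_i,\Gamma_i\in\mathbb{K}$ $(i\in F)$ with $\sum_{i\in F}\operatorname{Re}(\Phi_i\overline{\phi_i})>0$ and $\sum_{i\in F}\operatorname{Re}(\Gamma_i\overline{\gamma_i})>0$, and let $x,y\in H$. If either $$\operatorname{Re}\left\langle \sum_{i\in F}\Phi_i e_i-x,\;x-\sum_{i\in F}\phi_i e_i\right\rangle\ge 0,\qquad \operatorname{Re}\left\langle \sum_{i\in F}\Gamma_i e_i-y,\;y-\sum_{i\in F}\gamma_i e_i\right\rangle\ge 0,$$ or, equivalently, $$\left\|x-\sum_{i\in F}\frac{\Phi_i+\phi_i}{2}e_i\right\|\le \frac12\left(\sum_{i\in F}|\Phi_i-\phi_i|^2\right)^{1/2},\qquad \left\|y-\sum_{i\in F}\frac{\Gamma_i+\gamma_i}{2}e_i\right\|\le \frac12\left(\sum_{i\in F}|\Gamma_i-\gamma_i|^2\right)^{1/2}$$ hold, then $$0\le\left|\langle x,y\rangle-\sum_{i\in F}\langle x,e_i\rangle\langle e_i,y\rangle\right|\le \frac14 M(\mathbf{\Phi},\mathbf{\phi},F)\,M(\mathbf{\Gamma},\mathbf{\gamma},F)\left(\sum_{i\in F}|\langle x,e_i\rangle|^2\right)^{1/2}\left(\sum_{i\in F}|\langle y,e_i\rangle|^2\right)^{1/2}.$$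 The constant $\frac14$ is best possible: there is no $c<\frac14$ such that the second inequality with $c$ in place of $\frac14$ holds for all data satisfying the hypotheses.
   Context: The inner product is linear in the first argument and conjugate-linear in the second, and $\|x\|=\langle x,x\rangle^{1/2}$. A family $\{e_i\}_{i\in I}$ is orthonormal if $\langle e_i,e_j\rangle=0$ for $i\neq j$ and $\|e_i\|=1$ for all $i\in I$. For scalars $\phi_i,\Phi_i\in\mathbb{K}$ $(i\in F)$ with $\sum_{i\in F}\operatorname{Re}(\Phi_i\overline{\phi_i})>0$, $$M(\mathbf{\Phi},\mathbf{\phi},F):=\left[\frac{\sum_{i\in F}\left\{(|\Phi_i|-|\phi_i|)^2+4\left[|\Phi_i\overline{\phi_i}|-\operatorname{Re}(\Phi_i\overline{\phi_i})\right]\right\}}{\sum_{i\in F}\operatorname{Re}(\Phi_i\overline{\phi_i})}\right]^{1/2},$$ and $M(\mathbf{\Gamma},\mathbf{\gamma},F)$ is defined by the same formula with $\Gamma_i,\gamma_i$ in place of $\Phi_i,\phi_i$. *)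

theory Defs
  imports "HOL-Analysis.Analysis"
begin

text \<open>
  The scalar field is either the reals or the complex numbers. The class below has exactly these two
  models up to isomorphism: \<open>to_complex\<close> is an isometric embedding of real algebras onto
  \<open>\<real>\<close> or onto all of the complex plane.
\<close>

class real_or_complex = real_normed_field +
  fixes to_complex :: "'a \<Rightarrow> complex"
    and scalar_cnj :: "'a \<Rightarrow> 'a"
  assumes to_complex_add: "to_complex (a + b) = to_complex a + to_complex b"
    and to_complex_mult: "to_complex (a * b) = to_complex a * to_complex b"
    and to_complex_scaleR: "to_complex (r *\<^sub>R a) = r *\<^sub>R to_complex a"
    and norm_to_complex: "norm (to_complex a) = norm a"
    and range_to_complex: "range to_complex = \<real> \<or> range to_complex = UNIV"
    and to_complex_cnj: "to_complex (scalar_cnj a) = cnj (to_complex a)"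

definition scalar_Re :: "'k::real_or_complex \<Rightarrow> real" where
  "scalar_Re a = Re (to_complex a)"

instantiation real :: real_or_complex
begin
definition to_complex_real :: "real \<Rightarrow> complex" where
  "to_complex_real = complex_of_real"
definition scalar_cnj_real :: "real \<Rightarrow> real" where
  "scalar_cnj_real a = a"
instance
  by standard (auto simp: to_complex_real_def scalar_cnj_real_def scaleR_conv_of_real Reals_def)
end

instantiation complex :: real_or_complex
begin
definition to_complex_complex :: "complex \<Rightarrow> complex" where
  "to_complex_complex a = a"
definition scalar_cnj_complex :: "complex \<Rightarrow> complex" where
  "scalar_cnj_complex = cnj"
instance
  by standard (auto simp: to_complex_complex_def scalar_cnj_complex_def)
end

lemma scalar_Re_real [simp]: "scalar_Re (a::real) = a"
  by (simp add: scalar_Re_def to_complex_real_def)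

lemma scalar_Re_complex [simp]: "scalar_Re (a::complex) = Re a"
  by (simp add: scalar_Re_def to_complex_complex_def)

text \<open>
  The inner product is linear in the first argument. Conjugate symmetry makes it conjugate-linear in
  the second one and makes \<open>ip x x\<close> real, so that positivity can be stated for its real part.
\<close>

locale inner_product_space = vector_space scale
  for scale :: "'k::real_or_complex \<Rightarrow> 'h::ab_group_add \<Rightarrow> 'h" +
  fixes ip :: "'h \<Rightarrow> 'h \<Rightarrow> 'k"
  assumes ip_add_left: "ip (x + y) z = ip x z + ip y z"
    and ip_scale_left: "ip (scale a x) y = a * ip x y"
    and ip_commute: "ip y x = scalar_cnj (ip x y)"
    and ip_pos: "x \<noteq> 0 \<Longrightarrow> 0 < scalar_Re (ip x x)"

lemma inner_product_space_real_inner: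
  "inner_product_space scaleR (inner :: 'h::real_inner \<Rightarrow> 'h \<Rightarrow> real)"
  by unfold_locales
    (auto simp: inner_add_left inner_commute scalar_cnj_real_def algebra_simps)

lemma inner_product_space_complex:
  "inner_product_space (*) (\<lambda>x y :: complex. x * cnj y)"
  by unfold_locales
    (auto simp: scalar_cnj_complex_def algebra_simps complex_eq_iff
      sum_power2_gt_zero_iff simp flip: power2_eq_square)

definition ip_norm :: "('h \<Rightarrow> 'h \<Rightarrow> 'k::real_or_complex) \<Rightarrow> 'h \<Rightarrow> real" where
  "ip_norm ip x = sqrt (scalar_Re (ip x x))"

definition orthonormal_family ::
    "('h \<Rightarrow> 'h \<Rightarrow> 'k::real_or_complex) \<Rightarrow> 'i set \<Rightarrow> ('i \<Rightarrow> 'h) \<Rightarrow> bool" where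
  "orthonormal_family ip I e \<longleftrightarrow>
     (\<forall>i\<in>I. \<forall>j\<in>I. i \<noteq> j \<longrightarrow> ip (e i) (e j) = 0) \<and> (\<forall>i\<in>I. ip_norm ip (e i) = 1)"

definition M :: "('i \<Rightarrow> 'k::real_or_complex) \<Rightarrow> ('i \<Rightarrow> 'k) \<Rightarrow> 'i set \<Rightarrow> real" where
  "M \<Phi> \<phi> F = sqrt
     ((\<Sum>i\<in>F. (norm (\<Phi> i) - norm (\<phi> i))\<^sup>2
              + 4 * (norm (\<Phi> i * scalar_cnj (\<phi> i)) - scalar_Re (\<Phi> i * scalar_cnj (\<phi> i))))
      / (\<Sum>i\<in>F. scalar_Re (\<Phi> i * scalar_cnj (\<phi> i))))"

end

theory Submission
  imports Defs
begin

text \<open>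
  Write \<open>a\<^sub>i\<close> for the coefficient of \<open>x\<close> at \<open>e\<^sub>i\<close>, \<open>X\<close> for the sum of the \<open>\<bar>a\<^sub>i\<bar>\<^sup>2\<close>, and \<open>u\<close>, \<open>v\<close> for the
  components of \<open>x\<close>, \<open>y\<close> orthogonal to the vectors \<open>e\<^sub>i\<close>, \<open>i \<in> F\<close>. The quantity to be bounded is the inner
  product of \<open>u\<close> and \<open>v\<close>, so by the Cauchy--Schwarz inequality it suffices to bound \<open>\<parallel>u\<parallel>\<^sup>2 = \<parallel>x\<parallel>\<^sup>2 - X\<close> and
  \<open>\<parallel>v\<parallel>\<^sup>2\<close> separately.

  Put \<open>S = \<Sum> Re (\<Phi>\<^sub>i cnj \<phi>\<^sub>i)\<close> and \<open>N = \<Sum> (\<bar>\<Phi>\<^sub>i\<bar> + \<bar>\<phi>\<^sub>i\<bar>)\<^sup>2\<close>. Expanding the hypothesis on \<open>x\<close> and estimating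
  termwise gives \<open>\<parallel>x\<parallel>\<^sup>2 + S \<le> \<Sum> (\<bar>\<Phi>\<^sub>i\<bar> + \<bar>\<phi>\<^sub>i\<bar>) \<bar>a\<^sub>i\<bar> \<le> sqrt (N X)\<close>, and the arithmetic--geometric mean
  inequality bounds the right-hand side by \<open>S + N X / (4 S)\<close>. Hence \<open>\<parallel>u\<parallel>\<^sup>2 \<le> X (N - 4 S) / (4 S)\<close>, which
  is \<open>X M\<^sup>2 / 4\<close> (\<open>sqnorm_le_M\<close>); multiplying the square roots of the two bounds gives the theorem.

  The two forms of the hypothesis agree: both place \<open>x\<close> in the ball that has the segment from
  \<open>A = \<Sum> \<Phi>\<^sub>i e\<^sub>i\<close> to \<open>B = \<Sum> \<phi>\<^sub>i e\<^sub>i\<close> as a diameter. With \<open>d = (A - B) / 2\<close> and \<open>z = x - (A + B) / 2\<close>, the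
  inner product in the first form is that of \<open>d - z\<close> and \<open>z + d\<close>, whose real part is
  \<open>\<parallel>d\<parallel>\<^sup>2 - \<parallel>z\<parallel>\<^sup>2\<close>.

  For optimality, one orthonormal vector and \<open>x = y\<close> in the plane suffice: with \<open>\<Phi> = 4\<close> and \<open>\<phi> = 1\<close>
  every inequality above is an equality at \<open>x = (8/5, 6/5)\<close>.
\<close>

section \<open>Scalars\<close>

lemma to_complex_0 [simp]: "to_complex 0 = 0"
  using norm_to_complex[of 0] by simp

lemma to_complex_1 [simp]: "to_complex (1::'k::real_or_complex) = 1"
proof -
  have "to_complex (1::'k) * to_complex (1::'k) = to_complex (1::'k)"
    using to_complex_mult[of "1::'k" 1] by simp
  moreover have "to_complex (1::'k) \<noteq> 0"
    using norm_to_complex[of "1::'k"] by force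
  ultimately show ?thesis by simp
qed

lemma to_complex_of_real [simp]:
  "to_complex (of_real r :: 'k::real_or_complex) = complex_of_real r"
  unfolding of_real_def to_complex_scaleR by simp

lemma to_complex_minus [simp]: "to_complex (- a) = - to_complex a"
  using to_complex_add[of a "- a"] by (simp add: eq_neg_iff_add_eq_0 add.commute)

lemma to_complex_diff: "to_complex (a - b) = to_complex a - to_complex b"
  using to_complex_add[of a "- b"] by simp

lemma to_complex_sum: "to_complex (sum f A) = (\<Sum>i\<in>A. to_complex (f i))"
  by (induction A rule: infinite_finite_induct) (simp_all add: to_complex_add)

lemma to_complex_eqI: "a = b" if "to_complex a = to_complex b"
proof -
  have "norm (a - b) = 0"
    using that norm_to_complex[of "a - b"] by (simp add: to_complex_diff)
  then show ?thesis by simp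
qed

lemmas to_complex_hom = to_complex_add to_complex_mult to_complex_diff to_complex_sum to_complex_cnj

lemma scalar_cnj_add: "scalar_cnj (a + b) = scalar_cnj a + scalar_cnj b"
  by (rule to_complex_eqI) (simp add: to_complex_hom)

lemma scalar_cnj_mult: "scalar_cnj (a * b) = scalar_cnj a * scalar_cnj b"
  by (rule to_complex_eqI) (simp add: to_complex_hom)

lemma scalar_cnj_0 [simp]: "scalar_cnj 0 = 0"
  by (rule to_complex_eqI) (simp add: to_complex_hom)

lemma scalar_cnj_1 [simp]: "scalar_cnj 1 = 1"
  by (rule to_complex_eqI) (simp add: to_complex_hom)

lemma scalar_cnj_of_real [simp]: "scalar_cnj (of_real r) = of_real r"
  by (rule to_complex_eqI) (simp add: to_complex_hom)

lemma scalar_cnj_cnj [simp]: "scalar_cnj (scalar_cnj a) = a"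
  by (rule to_complex_eqI) (simp add: to_complex_hom)

lemma norm_scalar_cnj [simp]: "norm (scalar_cnj a) = norm a"
  by (metis norm_to_complex to_complex_cnj complex_mod_cnj)

lemma scalar_Re_add: "scalar_Re (a + b) = scalar_Re a + scalar_Re b"
  by (simp add: scalar_Re_def to_complex_hom)

lemma scalar_Re_diff: "scalar_Re (a - b) = scalar_Re a - scalar_Re b"
  by (simp add: scalar_Re_def to_complex_hom)

lemma scalar_Re_sum: "scalar_Re (sum f A) = (\<Sum>i\<in>A. scalar_Re (f i))"
  by (simp add: scalar_Re_def to_complex_hom)

lemma scalar_Re_of_real [simp]: "scalar_Re (of_real r) = r"
  by (simp add: scalar_Re_def)

lemma scalar_Re_cnj [simp]: "scalar_Re (scalar_cnj a) = scalar_Re a"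
  by (simp add: scalar_Re_def to_complex_hom)

lemma scalar_Re_le_norm: "scalar_Re a \<le> norm a"
  unfolding scalar_Re_def norm_to_complex[of a, symmetric] by (rule complex_Re_le_cmod)

lemma mult_scalar_cnj: "a * scalar_cnj a = of_real ((norm a)\<^sup>2)"
  unfolding norm_to_complex[of a, symmetric]
  by (rule to_complex_eqI) (simp add: to_complex_hom complex_norm_square del: of_real_power)

lemma scalar_cnj_eq_self: "a = of_real (scalar_Re a)" if "scalar_cnj a = a"
proof (rule to_complex_eqI)
  have "cnj (to_complex a) = to_complex a"
    using that by (simp flip: to_complex_cnj)
  then show "to_complex a = to_complex (of_real (scalar_Re a) :: 'a)"
    by (simp add: scalar_Re_def complex_eq_iff)
qed

text \<open>Hence the root in \<^const>\<open>M\<close> is taken of a nonnegative number and is cancelled by squaring.\<close>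

lemma M_numerator_nonneg:
  "0 \<le> (\<Sum>i\<in>F. (norm (\<Phi> i) - norm (\<phi> i))\<^sup>2
      + 4 * (norm (\<Phi> i * scalar_cnj (\<phi> i)) - scalar_Re (\<Phi> i * scalar_cnj (\<phi> i))))"
  by (intro sum_nonneg add_nonneg_nonneg) (simp_all add: scalar_Re_le_norm)

section \<open>Inner products\<close>

context inner_product_space
begin

lemma ip_zero_left [simp]: "ip 0 z = 0"
  using ip_scale_left[of 0 0 z] by simp

lemma ip_diff_left: "ip (x - y) z = ip x z - ip y z"
  using ip_add_left[of "x - y" y z] by simp

lemma ip_sum_left: "ip (sum f A) z = (\<Sum>i\<in>A. ip (f i) z)"
  by (induction A rule: infinite_finite_induct) (simp_all add: ip_add_left)

lemma ip_add_right: "ip x (y + z) = ip x y + ip x z"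
  by (metis ip_commute ip_add_left scalar_cnj_add)

lemma ip_zero_right [simp]: "ip x 0 = 0"
  by (metis ip_commute ip_zero_left scalar_cnj_0)

lemma ip_diff_right: "ip x (y - z) = ip x y - ip x z"
  using ip_add_right[of x "y - z" z] by simp

lemma ip_scale_right: "ip x (scale a y) = scalar_cnj a * ip x y"
  by (metis ip_commute ip_scale_left scalar_cnj_mult)

lemma ip_sum_right: "ip x (sum f A) = (\<Sum>i\<in>A. ip x (f i))"
  by (induction A rule: infinite_finite_induct) (simp_all add: ip_add_right)

lemmas ip_linear = ip_add_left ip_add_right ip_diff_left ip_diff_right
  ip_scale_left ip_scale_right ip_sum_left ip_sum_right

definition sqnorm :: "'h \<Rightarrow> real" where
  "sqnorm x = scalar_Re (ip x x)"

lemma ip_self: "ip x x = of_real (sqnorm x)"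
  unfolding sqnorm_def by (rule scalar_cnj_eq_self) (rule ip_commute[symmetric])

lemma sqnorm_nonneg: "0 \<le> sqnorm x"
  using ip_pos[of x] unfolding sqnorm_def by (cases "x = 0") (auto simp: scalar_Re_def)

lemma norm_ip_commute: "norm (ip y x) = norm (ip x y)"
  by (subst ip_commute) simp

text \<open>The square of the component of \<open>x\<close> orthogonal to \<open>y\<close> is nonnegative.\<close>

lemma Cauchy_Schwarz: "(norm (ip x y))\<^sup>2 \<le> sqnorm x * sqnorm y"
proof (cases "y = 0")
  case True
  then show ?thesis by (simp add: sqnorm_def scalar_Re_def)
next
  case False
  define n where "n = sqnorm y"
  have n: "n > 0" using ip_pos[OF False] by (simp add: n_def sqnorm_def)
  define c where "c = ip x y / of_real n"
  have ip_xy: "ip x y = c * of_real n"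
    using n by (simp add: c_def)
  then have ip_yx: "ip y x = scalar_cnj c * of_real n"
    by (subst ip_commute) (simp add: scalar_cnj_mult)
  have "ip (x - scale c y) (x - scale c y) = ip x x - c * scalar_cnj c * of_real n"
    by (simp add: ip_linear ip_xy ip_yx ip_self[of y] flip: n_def)
  also have "\<dots> = of_real (sqnorm x - (norm c)\<^sup>2 * n)"
    by (simp add: mult_scalar_cnj ip_self)
  finally have "sqnorm (x - scale c y) = sqnorm x - (norm c)\<^sup>2 * n"
    by (simp add: sqnorm_def[of "x - scale c y"] del: of_real_diff of_real_mult)
  then have "(norm c)\<^sup>2 * n \<le> sqnorm x"
    using sqnorm_nonneg[of "x - scale c y"] by simp
  then have "(norm c)\<^sup>2 * n * n \<le> sqnorm x * n"
    using n by (intro mult_right_mono) auto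
  then show ?thesis
    using n by (simp add: ip_xy norm_mult power_mult_distrib power2_eq_square mult_ac flip: n_def)
qed

section \<open>Orthonormal families\<close>

lemma orthonormal_ip:
  assumes "orthonormal_family ip I e" "i \<in> I" "j \<in> I"
  shows "ip (e i) (e j) = (if i = j then 1 else 0)"
proof -
  have "sqnorm (e i) = 1"
    using assms by (auto simp: orthonormal_family_def ip_norm_def sqnorm_def)
  then show ?thesis
    using assms by (auto simp: orthonormal_family_def ip_self)
qed

context
  fixes I :: "'i set" and e F
  assumes orthonormal: "orthonormal_family ip I e" and finite_F: "finite F" and F_subset: "F \<subseteq> I"
begin

lemma ip_orthonormal_F: "i \<in> F \<Longrightarrow> j \<in> F \<Longrightarrow> ip (e i) (e j) = (if i = j then 1 else 0)"
  using orthonormal_ip[OF orthonormal] F_subset by blast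

lemma ip_combination:
  "ip (\<Sum>i\<in>F. scale (a i) (e i)) (\<Sum>i\<in>F. scale (b i) (e i)) = (\<Sum>i\<in>F. a i * scalar_cnj (b i))"
proof -
  have "ip (\<Sum>i\<in>F. scale (a i) (e i)) (\<Sum>i\<in>F. scale (b i) (e i))
      = (\<Sum>i\<in>F. \<Sum>j\<in>F. if i = j then a j * scalar_cnj (b j) else 0)"
    unfolding ip_sum_left ip_sum_right
    by (intro sum.cong refl) (auto simp: ip_linear ip_orthonormal_F)
  also have "\<dots> = (\<Sum>i\<in>F. a i * scalar_cnj (b i))"
    using finite_F by (intro sum.cong refl) simp
  finally show ?thesis .
qed

lemma sqnorm_combination: "sqnorm (\<Sum>i\<in>F. scale (a i) (e i)) = (\<Sum>i\<in>F. (norm (a i))\<^sup>2)"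
  by (simp add: sqnorm_def ip_combination mult_scalar_cnj scalar_Re_sum del: of_real_power)

definition residual :: "'h \<Rightarrow> 'h" where
  "residual x = x - (\<Sum>i\<in>F. scale (ip x (e i)) (e i))"

text \<open>
  Subtracting the projection in both arguments has the same effect as in one of them, because the
  residual is orthogonal to the range of the projection.
\<close>

lemma ip_residual: "ip (residual x) (residual y) = ip x y - (\<Sum>i\<in>F. ip x (e i) * ip (e i) y)"
proof -
  have "ip x (\<Sum>i\<in>F. scale (ip y (e i)) (e i)) = (\<Sum>i\<in>F. ip x (e i) * ip (e i) y)"
    unfolding ip_sum_right ip_scale_right
    by (intro sum.cong refl) (simp add: mult.commute flip: ip_commute)
  moreover have "ip (\<Sum>i\<in>F. scale (ip x (e i)) (e i)) (\<Sum>i\<in>F. scale (ip y (e i)) (e i))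
      = (\<Sum>i\<in>F. ip x (e i) * ip (e i) y)"
    unfolding ip_combination by (simp flip: ip_commute)
  moreover have "ip (\<Sum>i\<in>F. scale (ip x (e i)) (e i)) y = (\<Sum>i\<in>F. ip x (e i) * ip (e i) y)"
    unfolding ip_sum_left ip_scale_left ..
  ultimately show ?thesis
    by (simp add: residual_def ip_diff_left ip_diff_right)
qed

lemma sqnorm_residual: "sqnorm (residual x) = sqnorm x - (\<Sum>i\<in>F. (norm (ip x (e i)))\<^sup>2)"
proof -
  have "ip x (e i) * ip (e i) x = of_real ((norm (ip x (e i)))\<^sup>2)" for i
    using mult_scalar_cnj[of "ip x (e i)"] by (simp flip: ip_commute)
  then show ?thesis
    unfolding sqnorm_def[of "residual x"] ip_residual
    by (simp add: scalar_Re_diff scalar_Re_sum sqnorm_def del: of_real_power)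
qed

section \<open>The two forms of the hypothesis\<close>

text \<open>The cross terms are conjugate to each other and cancel in the real part.\<close>

lemma Re_ip_diff_add: "scalar_Re (ip (d - z) (z + d)) = sqnorm d - sqnorm z"
proof -
  have "scalar_Re (ip d z) = scalar_Re (ip z d)"
    by (subst ip_commute) simp
  then show ?thesis
    by (simp add: ip_linear sqnorm_def scalar_Re_add scalar_Re_diff)
qed

lemma Re_ip_nonneg_iff_ball:
  "scalar_Re (ip ((\<Sum>i\<in>F. scale (\<Phi> i) (e i)) - x) (x - (\<Sum>i\<in>F. scale (\<phi> i) (e i)))) \<ge> 0
   \<longleftrightarrow> ip_norm ip (x - (\<Sum>i\<in>F. scale ((\<Phi> i + \<phi> i) / 2) (e i)))
          \<le> 1 / 2 * sqrt (\<Sum>i\<in>F. (norm (\<Phi> i - \<phi> i))\<^sup>2)"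
proof -
  define m where "m = (\<Sum>i\<in>F. scale ((\<Phi> i + \<phi> i) / 2) (e i))"
  define d where "d = (\<Sum>i\<in>F. scale ((\<Phi> i - \<phi> i) / 2) (e i))"
  define z where "z = x - m"
  have half: "(a - b) / 2 + (a + b) / 2 = a" "(a + b) / 2 - (a - b) / 2 = b" for a b :: 'k
    by (simp_all add: field_simps)
  have "d + m = (\<Sum>i\<in>F. scale (\<Phi> i) (e i))"
    unfolding m_def d_def sum.distrib[symmetric] scale_left_distrib[symmetric] half ..
  from this[symmetric] have 1: "(\<Sum>i\<in>F. scale (\<Phi> i) (e i)) - x = d - z"
    by (simp add: z_def)
  have "m - d = (\<Sum>i\<in>F. scale (\<phi> i) (e i))"
    unfolding m_def d_def sum_subtractf[symmetric] scale_left_diff_distrib[symmetric] half ..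
  from this[symmetric] have 2: "x - (\<Sum>i\<in>F. scale (\<phi> i) (e i)) = z + d"
    by (simp add: z_def)
  have "sqnorm d = 1 / 4 * (\<Sum>i\<in>F. (norm (\<Phi> i - \<phi> i))\<^sup>2)"
    by (simp add: d_def sqnorm_combination norm_divide power_divide sum_divide_distrib)
  then have "sqrt (sqnorm d) = 1 / 2 * sqrt (\<Sum>i\<in>F. (norm (\<Phi> i - \<phi> i))\<^sup>2)"
    by (simp only: real_sqrt_mult) (simp add: real_sqrt_divide)
  then show ?thesis
    using real_sqrt_le_iff[of "sqnorm z" "sqnorm d"]
    unfolding 1 2 Re_ip_diff_add m_def[symmetric] z_def[symmetric] ip_norm_def
      sqnorm_def[of z, symmetric] by linarith
qed

section \<open>The distance to the span\<close>

text \<open>The termwise estimate of the expanded hypothesis, followed by the Cauchy inequality for sums.\<close>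

lemma sqnorm_add_le:
  assumes "scalar_Re (ip ((\<Sum>i\<in>F. scale (\<Phi> i) (e i)) - x) (x - (\<Sum>i\<in>F. scale (\<phi> i) (e i)))) \<ge> 0"
  shows "sqnorm x + (\<Sum>i\<in>F. scalar_Re (\<Phi> i * scalar_cnj (\<phi> i)))
    \<le> sqrt (\<Sum>i\<in>F. (norm (\<Phi> i) + norm (\<phi> i))\<^sup>2) * sqrt (\<Sum>i\<in>F. (norm (ip x (e i)))\<^sup>2)"
proof -
  have "sqnorm x + (\<Sum>i\<in>F. scalar_Re (\<Phi> i * scalar_cnj (\<phi> i)))
      \<le> scalar_Re (ip (\<Sum>i\<in>F. scale (\<Phi> i) (e i)) x) + scalar_Re (ip x (\<Sum>i\<in>F. scale (\<phi> i) (e i)))"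
    using assms unfolding ip_diff_left ip_diff_right ip_combination
    by (simp add: scalar_Re_diff scalar_Re_sum sqnorm_def)
  also have "\<dots> = (\<Sum>i\<in>F. scalar_Re (\<Phi> i * ip (e i) x + scalar_cnj (\<phi> i) * ip x (e i)))"
    by (simp add: ip_linear scalar_Re_sum scalar_Re_add sum.distrib)
  also have "\<dots> \<le> (\<Sum>i\<in>F. (norm (\<Phi> i) + norm (\<phi> i)) * norm (ip x (e i)))"
  proof (rule sum_mono)
    fix i
    have "scalar_Re (\<Phi> i * ip (e i) x + scalar_cnj (\<phi> i) * ip x (e i))
        \<le> norm (\<Phi> i * ip (e i) x) + norm (scalar_cnj (\<phi> i) * ip x (e i))"
      by (intro order_trans[OF scalar_Re_le_norm] norm_triangle_ineq)
    then show "scalar_Re (\<Phi> i * ip (e i) x + scalar_cnj (\<phi> i) * ip x (e i))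
        \<le> (norm (\<Phi> i) + norm (\<phi> i)) * norm (ip x (e i))"
      by (simp add: norm_mult norm_ip_commute distrib_right)
  qed
  also have "\<dots> \<le> L2_set (\<lambda>i. norm (\<Phi> i) + norm (\<phi> i)) F * L2_set (\<lambda>i. norm (ip x (e i))) F"
    using L2_set_mult_ineq[of "\<lambda>i. norm (\<Phi> i) + norm (\<phi> i)" "\<lambda>i. norm (ip x (e i))" F] by simp
  finally show ?thesis
    by (simp add: L2_set_def)
qed

text \<open>
  The numerator of \<open>M\<^sup>2\<close> regroups because \<open>(\<bar>\<Phi>\<^sub>i\<bar> - \<bar>\<phi>\<^sub>i\<bar>)\<^sup>2 + 4 \<bar>\<Phi>\<^sub>i cnj \<phi>\<^sub>i\<bar> = (\<bar>\<Phi>\<^sub>i\<bar> + \<bar>\<phi>\<^sub>i\<bar>)\<^sup>2\<close>; this is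
  the form in which it meets the estimate above.
\<close>

lemma M_sq_mult:
  assumes "(\<Sum>i\<in>F. scalar_Re (\<Phi> i * scalar_cnj (\<phi> i))) > 0"
  shows "(M \<Phi> \<phi> F)\<^sup>2 * (\<Sum>i\<in>F. scalar_Re (\<Phi> i * scalar_cnj (\<phi> i)))
    = (\<Sum>i\<in>F. (norm (\<Phi> i) + norm (\<phi> i))\<^sup>2) - 4 * (\<Sum>i\<in>F. scalar_Re (\<Phi> i * scalar_cnj (\<phi> i)))"
proof -
  have "(M \<Phi> \<phi> F)\<^sup>2 * (\<Sum>i\<in>F. scalar_Re (\<Phi> i * scalar_cnj (\<phi> i)))
      = (\<Sum>i\<in>F. (norm (\<Phi> i) - norm (\<phi> i))\<^sup>2
          + 4 * (norm (\<Phi> i * scalar_cnj (\<phi> i)) - scalar_Re (\<Phi> i * scalar_cnj (\<phi> i))))"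
    using assms M_numerator_nonneg[of \<Phi> \<phi> F] unfolding M_def
    by (subst real_sqrt_pow2) (auto intro: divide_nonneg_pos)
  also have "\<dots> = (\<Sum>i\<in>F. (norm (\<Phi> i) + norm (\<phi> i))\<^sup>2 - 4 * scalar_Re (\<Phi> i * scalar_cnj (\<phi> i)))"
    by (intro sum.cong refl) (simp add: norm_mult power2_sum power2_diff)
  finally show ?thesis
    by (simp add: sum_subtractf sum_distrib_left)
qed

lemma sqnorm_le_M:
  assumes S: "(\<Sum>i\<in>F. scalar_Re (\<Phi> i * scalar_cnj (\<phi> i))) > 0"
    and "scalar_Re (ip ((\<Sum>i\<in>F. scale (\<Phi> i) (e i)) - x) (x - (\<Sum>i\<in>F. scale (\<phi> i) (e i)))) \<ge> 0"
  shows "sqrt (sqnorm (residual x)) \<le> 1 / 2 * M \<Phi> \<phi> F * sqrt (\<Sum>i\<in>F. (norm (ip x (e i)))\<^sup>2)"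
proof -
  define S where "S = (\<Sum>i\<in>F. scalar_Re (\<Phi> i * scalar_cnj (\<phi> i)))"
  define N where "N = (\<Sum>i\<in>F. (norm (\<Phi> i) + norm (\<phi> i))\<^sup>2)"
  define X where "X = (\<Sum>i\<in>F. (norm (ip x (e i)))\<^sup>2)"
  have pos: "S > 0" "N \<ge> 0" "X \<ge> 0"
    using S by (auto simp: S_def N_def X_def intro: sum_nonneg)
  have "(sqnorm x + S) * (4 * S) \<le> 2 * (2 * S) * (sqrt N * sqrt X)"
    using sqnorm_add_le[OF assms(2)] pos by (simp add: S_def N_def X_def)
  \<comment> \<open>the arithmetic--geometric mean inequality for \<open>2 S\<close> and \<open>sqrt (N X)\<close>\<close>
  also have "\<dots> \<le> (2 * S)\<^sup>2 + (sqrt N * sqrt X)\<^sup>2"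
    by (rule sum_squares_bound)
  also have "\<dots> = 4 * S * S + N * X"
    using pos by (simp add: power_mult_distrib) (simp add: power2_eq_square)
  finally have "4 * S * (sqnorm x - X) \<le> (N - 4 * S) * X"
    by (simp add: algebra_simps)
  also have "N - 4 * S = (M \<Phi> \<phi> F)\<^sup>2 * S"
    using M_sq_mult[OF S] by (simp add: S_def N_def)
  finally have "S * (4 * (sqnorm x - X)) \<le> S * ((M \<Phi> \<phi> F)\<^sup>2 * X)"
    by (simp add: mult_ac)
  then have "4 * sqnorm (residual x) \<le> (M \<Phi> \<phi> F)\<^sup>2 * X"
    using pos by (simp add: sqnorm_residual X_def)
  also have "\<dots> = 4 * (1 / 2 * M \<Phi> \<phi> F * sqrt X)\<^sup>2"
    using pos by (simp add: power_mult_distrib power_divide)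
  finally have "sqnorm (residual x) \<le> (1 / 2 * M \<Phi> \<phi> F * sqrt X)\<^sup>2"
    by simp
  moreover have "0 \<le> M \<Phi> \<phi> F"
    using pos M_numerator_nonneg[of \<Phi> \<phi> F] by (simp add: M_def S_def)
  ultimately show ?thesis
    using pos unfolding X_def[symmetric] by (intro real_le_lsqrt) auto
qed

lemma Gruss_bound:
  assumes "(\<Sum>i\<in>F. scalar_Re (\<Phi> i * scalar_cnj (\<phi> i))) > 0"
    and "(\<Sum>i\<in>F. scalar_Re (\<Gamma> i * scalar_cnj (\<gamma> i))) > 0"
    and "scalar_Re (ip ((\<Sum>i\<in>F. scale (\<Phi> i) (e i)) - x) (x - (\<Sum>i\<in>F. scale (\<phi> i) (e i)))) \<ge> 0"
    and "scalar_Re (ip ((\<Sum>i\<in>F. scale (\<Gamma> i) (e i)) - y) (y - (\<Sum>i\<in>F. scale (\<gamma> i) (e i)))) \<ge> 0"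
  shows "norm (ip x y - (\<Sum>i\<in>F. ip x (e i) * ip (e i) y))
         \<le> 1 / 4 * M \<Phi> \<phi> F * M \<Gamma> \<gamma> F
             * sqrt (\<Sum>i\<in>F. (norm (ip x (e i)))\<^sup>2) * sqrt (\<Sum>i\<in>F. (norm (ip y (e i)))\<^sup>2)"
proof -
  have "norm (ip (residual x) (residual y)) \<le> sqrt (sqnorm (residual x) * sqnorm (residual y))"
    by (intro real_le_rsqrt Cauchy_Schwarz)
  also have "\<dots> = sqrt (sqnorm (residual x)) * sqrt (sqnorm (residual y))"
    by (rule real_sqrt_mult)
  also have "\<dots> \<le> (1 / 2 * M \<Phi> \<phi> F * sqrt (\<Sum>i\<in>F. (norm (ip x (e i)))\<^sup>2))
      * (1 / 2 * M \<Gamma> \<gamma> F * sqrt (\<Sum>i\<in>F. (norm (ip y (e i)))\<^sup>2))"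
    using sqnorm_le_M[OF assms(1,3)] sqnorm_le_M[OF assms(2,4)]
    by (intro mult_mono') (auto simp: sqnorm_nonneg)
  finally show ?thesis
    unfolding ip_residual by (simp add: mult_ac)
qed

end

end

section \<open>Optimality\<close>

definition plane_scale :: "'k::real_or_complex \<Rightarrow> 'k \<times> 'k \<Rightarrow> 'k \<times> 'k" where
  "plane_scale a x = (a * fst x, a * snd x)"

definition plane_ip :: "'k::real_or_complex \<times> 'k \<Rightarrow> 'k \<times> 'k \<Rightarrow> 'k" where
  "plane_ip x y = fst x * scalar_cnj (fst y) + snd x * scalar_cnj (snd y)"

lemma inner_product_space_plane:
  "inner_product_space plane_scale (plane_ip :: 'k::real_or_complex \<times> 'k \<Rightarrow> _)"
proof
  fix x :: "'k \<times> 'k"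
  assume "x \<noteq> 0"
  then have "0 < (norm (fst x))\<^sup>2 \<or> 0 < (norm (snd x))\<^sup>2"
    by (auto simp: prod_eq_iff)
  then have "0 < (norm (fst x))\<^sup>2 + (norm (snd x))\<^sup>2"
    by (metis add_pos_nonneg add_nonneg_pos zero_le_power2)
  then show "0 < scalar_Re (plane_ip x x)"
    by (simp add: plane_ip_def mult_scalar_cnj scalar_Re_add del: of_real_power)
qed (simp_all add: plane_scale_def plane_ip_def distrib_left distrib_right mult.assoc mult.commute
    scalar_cnj_add scalar_cnj_mult)

lemma plane_ip_of_real:
  "plane_ip (of_real a, of_real b) (of_real c, of_real d) = of_real (a * c + b * d)"
  by (simp add: plane_ip_def)

text \<open>
  For one vector and positive real \<open>\<Phi>\<close> and \<open>\<phi>\<close>, equality in every step of the upper bound requires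
  \<open>\<parallel>x\<parallel>\<^sup>2 = \<Phi> \<phi>\<close> and \<open>a = 2 \<Phi> \<phi> / (\<Phi> + \<phi>)\<close> for the coefficient \<open>a\<close> of \<open>x\<close>; the values \<open>\<Phi> = 4\<close>, \<open>\<phi> = 1\<close> make both coordinates of \<open>x\<close> rational.
\<close>

lemma plane_extremal:
  fixes i :: 'i
  defines "e \<equiv> (\<lambda>_::'i. (of_real 1, of_real 0) :: 'k::real_or_complex \<times> 'k)"
    and "x \<equiv> (of_real (8/5), of_real (6/5)) :: 'k \<times> 'k"
    and "\<Phi> \<equiv> (\<lambda>_::'i. of_real 4 :: 'k)" and "\<phi> \<equiv> (\<lambda>_::'i. of_real 1 :: 'k)"
  shows "orthonormal_family plane_ip {i} e"
    and "(\<Sum>j\<in>{i}. scalar_Re (\<Phi> j * scalar_cnj (\<phi> j))) = 4"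
    and "scalar_Re (plane_ip ((\<Sum>j\<in>{i}. plane_scale (\<Phi> j) (e j)) - x)
           (x - (\<Sum>j\<in>{i}. plane_scale (\<phi> j) (e j)))) = 0"
    and "norm (plane_ip x x - (\<Sum>j\<in>{i}. plane_ip x (e j) * plane_ip (e j) x)) = 36 / 25"
    and "M \<Phi> \<phi> {i} = 3 / 2"
    and "sqrt (\<Sum>j\<in>{i}. (norm (plane_ip x (e j)))\<^sup>2) = 8 / 5"
proof -
  have Phi_phi: "\<Phi> j * scalar_cnj (\<phi> j) = of_real 4" for j
    by (simp add: \<Phi>_def \<phi>_def flip: of_real_mult)
  have x_e: "plane_ip x (e j) = of_real (8/5)" and e_x: "plane_ip (e j) x = of_real (8/5)" for j
    by (simp_all only: x_def e_def plane_ip_of_real) simp_all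
  have x_x: "plane_ip x x = of_real 4"
    by (simp only: x_def plane_ip_of_real) simp
  have upper: "plane_scale (\<Phi> j) (e j) - x = (of_real (12/5), of_real (- (6/5)))"
    and lower: "x - plane_scale (\<phi> j) (e j) = (of_real (3/5), of_real (6/5))" for j
    unfolding e_def x_def \<Phi>_def \<phi>_def plane_scale_def fst_conv snd_conv diff_Pair
      of_real_mult[symmetric] of_real_diff[symmetric]
    by (intro arg_cong2[where f = Pair] arg_cong[where f = of_real]; simp)+
  show "orthonormal_family plane_ip {i} e"
    by (simp add: orthonormal_family_def ip_norm_def e_def plane_ip_of_real
        del: of_real_1 of_real_0)
  show "(\<Sum>j\<in>{i}. scalar_Re (\<Phi> j * scalar_cnj (\<phi> j))) = 4"
    unfolding Phi_phi scalar_Re_of_real by simp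
  have "plane_ip (plane_scale (\<Phi> i) (e i) - x) (x - plane_scale (\<phi> i) (e i)) = of_real 0"
    unfolding upper lower plane_ip_of_real by simp
  then show "scalar_Re (plane_ip ((\<Sum>j\<in>{i}. plane_scale (\<Phi> j) (e j)) - x)
      (x - (\<Sum>j\<in>{i}. plane_scale (\<phi> j) (e j)))) = 0"
    by (simp add: scalar_Re_def)
  have "plane_ip x x - plane_ip x (e i) * plane_ip (e i) x = of_real (36/25)"
    unfolding x_x x_e e_x of_real_mult[symmetric] of_real_diff[symmetric] by simp
  then show "norm (plane_ip x x - (\<Sum>j\<in>{i}. plane_ip x (e j) * plane_ip (e j) x)) = 36 / 25"
    by (simp del: of_real_divide of_real_numeral)
  have "M \<Phi> \<phi> {i} = sqrt ((3/2)\<^sup>2)"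
    unfolding M_def Phi_phi scalar_Re_of_real
    by (simp add: \<Phi>_def \<phi>_def power2_eq_square)
  then show "M \<Phi> \<phi> {i} = 3 / 2"
    by simp
  show "sqrt (\<Sum>j\<in>{i}. (norm (plane_ip x (e j)))\<^sup>2) = 8 / 5"
    unfolding x_e norm_of_real by simp
qed

theorem theorem4:
  "(\<forall>(scale :: 'k::real_or_complex \<Rightarrow> 'h::ab_group_add \<Rightarrow> 'h) (ip :: 'h \<Rightarrow> 'h \<Rightarrow> 'k)
      (I :: 'i set) (e :: 'i \<Rightarrow> 'h) (F :: 'i set)
      (\<Phi> :: 'i \<Rightarrow> 'k) (\<phi> :: 'i \<Rightarrow> 'k) (\<Gamma> :: 'i \<Rightarrow> 'k) (\<gamma> :: 'i \<Rightarrow> 'k) (x :: 'h) (y :: 'h).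
      inner_product_space scale ip \<and> orthonormal_family ip I e \<and> finite F \<and> F \<subseteq> I \<and>
      (\<Sum>i\<in>F. scalar_Re (\<Phi> i * scalar_cnj (\<phi> i))) > 0 \<and>
      (\<Sum>i\<in>F. scalar_Re (\<Gamma> i * scalar_cnj (\<gamma> i))) > 0
      \<longrightarrow>
      ((scalar_Re (ip ((\<Sum>i\<in>F. scale (\<Phi> i) (e i)) - x) (x - (\<Sum>i\<in>F. scale (\<phi> i) (e i)))) \<ge> 0 \<and>
        scalar_Re (ip ((\<Sum>i\<in>F. scale (\<Gamma> i) (e i)) - y) (y - (\<Sum>i\<in>F. scale (\<gamma> i) (e i)))) \<ge> 0)
       \<longleftrightarrow>
       (ip_norm ip (x - (\<Sum>i\<in>F. scale ((\<Phi> i + \<phi> i) / 2) (e i)))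
          \<le> 1 / 2 * sqrt (\<Sum>i\<in>F. (norm (\<Phi> i - \<phi> i))\<^sup>2) \<and>
        ip_norm ip (y - (\<Sum>i\<in>F. scale ((\<Gamma> i + \<gamma> i) / 2) (e i)))
          \<le> 1 / 2 * sqrt (\<Sum>i\<in>F. (norm (\<Gamma> i - \<gamma> i))\<^sup>2)))
      \<and>
      ((scalar_Re (ip ((\<Sum>i\<in>F. scale (\<Phi> i) (e i)) - x) (x - (\<Sum>i\<in>F. scale (\<phi> i) (e i)))) \<ge> 0 \<and>
        scalar_Re (ip ((\<Sum>i\<in>F. scale (\<Gamma> i) (e i)) - y) (y - (\<Sum>i\<in>F. scale (\<gamma> i) (e i)))) \<ge> 0)
       \<or>
       (ip_norm ip (x - (\<Sum>i\<in>F. scale ((\<Phi> i + \<phi> i) / 2) (e i)))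
          \<le> 1 / 2 * sqrt (\<Sum>i\<in>F. (norm (\<Phi> i - \<phi> i))\<^sup>2) \<and>
        ip_norm ip (y - (\<Sum>i\<in>F. scale ((\<Gamma> i + \<gamma> i) / 2) (e i)))
          \<le> 1 / 2 * sqrt (\<Sum>i\<in>F. (norm (\<Gamma> i - \<gamma> i))\<^sup>2))
       \<longrightarrow>
       0 \<le> norm (ip x y - (\<Sum>i\<in>F. ip x (e i) * ip (e i) y)) \<and>
       norm (ip x y - (\<Sum>i\<in>F. ip x (e i) * ip (e i) y))
         \<le> 1 / 4 * M \<Phi> \<phi> F * M \<Gamma> \<gamma> F
             * sqrt (\<Sum>i\<in>F. (norm (ip x (e i)))\<^sup>2) * sqrt (\<Sum>i\<in>F. (norm (ip y (e i)))\<^sup>2)))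
   \<and>
   \<not> (\<exists>c < 1 / 4.
      \<forall>(scale :: 'k \<Rightarrow> 'k \<times> 'k \<Rightarrow> 'k \<times> 'k) (ip :: 'k \<times> 'k \<Rightarrow> 'k \<times> 'k \<Rightarrow> 'k)
        (I :: 'i set) (e :: 'i \<Rightarrow> 'k \<times> 'k) (F :: 'i set)
        (\<Phi> :: 'i \<Rightarrow> 'k) (\<phi> :: 'i \<Rightarrow> 'k) (\<Gamma> :: 'i \<Rightarrow> 'k) (\<gamma> :: 'i \<Rightarrow> 'k) (x :: 'k \<times> 'k) (y :: 'k \<times> 'k).
        inner_product_space scale ip \<and> orthonormal_family ip I e \<and> finite F \<and> F \<subseteq> I \<and>
        (\<Sum>i\<in>F. scalar_Re (\<Phi> i * scalar_cnj (\<phi> i))) > 0 \<and>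
        (\<Sum>i\<in>F. scalar_Re (\<Gamma> i * scalar_cnj (\<gamma> i))) > 0 \<and>
        ((scalar_Re (ip ((\<Sum>i\<in>F. scale (\<Phi> i) (e i)) - x) (x - (\<Sum>i\<in>F. scale (\<phi> i) (e i)))) \<ge> 0 \<and>
          scalar_Re (ip ((\<Sum>i\<in>F. scale (\<Gamma> i) (e i)) - y) (y - (\<Sum>i\<in>F. scale (\<gamma> i) (e i)))) \<ge> 0)
         \<or>
         (ip_norm ip (x - (\<Sum>i\<in>F. scale ((\<Phi> i + \<phi> i) / 2) (e i)))
            \<le> 1 / 2 * sqrt (\<Sum>i\<in>F. (norm (\<Phi> i - \<phi> i))\<^sup>2) \<and>
          ip_norm ip (y - (\<Sum>i\<in>F. scale ((\<Gamma> i + \<gamma> i) / 2) (e i)))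
            \<le> 1 / 2 * sqrt (\<Sum>i\<in>F. (norm (\<Gamma> i - \<gamma> i))\<^sup>2)))
        \<longrightarrow>
        norm (ip x y - (\<Sum>i\<in>F. ip x (e i) * ip (e i) y))
          \<le> c * M \<Phi> \<phi> F * M \<Gamma> \<gamma> F
              * sqrt (\<Sum>i\<in>F. (norm (ip x (e i)))\<^sup>2) * sqrt (\<Sum>i\<in>F. (norm (ip y (e i)))\<^sup>2))"
proof (intro conjI allI impI notI, goal_cases)
  case (1 scale ip I e F \<Phi> \<phi> \<Gamma> \<gamma> x y)
  then interpret inner_product_space scale ip by blast
  show ?case
    using 1 by (intro arg_cong2[where f = "(\<and>)"] Re_ip_nonneg_iff_ball[of I]) blast+
next
  case (2 scale ip I e F \<Phi> \<phi> \<Gamma> \<gamma> x y)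
  show ?case by (rule norm_ge_zero)
next
  case (3 scale ip I e F \<Phi> \<phi> \<Gamma> \<gamma> x y)
  then interpret inner_product_space scale ip by blast
  have ortho: "orthonormal_family ip I e" "finite F" "F \<subseteq> I"
    using 3 by blast+
  show ?case
    using 3 Re_ip_nonneg_iff_ball[OF ortho] by (intro Gruss_bound[OF ortho]) blast+
next
  case 4
  then show ?case
  proof (elim exE conjE, goal_cases)
    case (1 c)
    note extremal = plane_extremal[where ?'k = 'k and i = "undefined :: 'i"]
    let ?e = "\<lambda>_::'i. (of_real 1, of_real 0) :: 'k \<times> 'k"
    let ?x = "(of_real (8/5), of_real (6/5)) :: 'k \<times> 'k"
    let ?\<Phi> = "\<lambda>_::'i. of_real 4 :: 'k"
    let ?\<phi> = "\<lambda>_::'i. of_real 1 :: 'k"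
    note bound = 1(2)[rule_format, of plane_scale plane_ip "{undefined}" ?e "{undefined}"
        ?\<Phi> ?\<phi> ?\<Phi> ?\<phi> ?x ?x, unfolded extremal(2-6)]
    have "36 / 25 \<le> c * (3 / 2) * (3 / 2) * (8 / 5) * (8 / 5 :: real)"
      by (rule bound) (intro conjI disjI1 inner_product_space_plane extremal(1); simp)
    then show False using 1(1) by simp
  qed
qed

end
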